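(* Let $1<\alpha\le2$, let $K_1,K_2\ge0$ be constants with $K_1^2+K_2^2\neq0$, and let $(p,q)\in\{(1,0),(1,-1)\}$. Let $u$ be the exact (unique and sufficiently smooth) solution of the problem $$\begin{cases}\frac{\partial u(x,t)}{\partial t}=K_1\,{}_aD_x^{\alpha}u(x,t)+K_2\,{}_xD_b^{\alpha}u(x,t)+f(x,t), & (x,t)\in(a,b)\times(0,T],\\ u(x,0)=u_0(x), & x\in[a,b],\\ u(a,t)=\phi_a(t),\quad u(b,t)=\phi_b(t), & t\in[0,T],\end{cases}$$ where $\phi_a\equiv0$ if $K_1\neq0$ and $\phi_b\equiv0$ if $K_2\neq0$. Put $u_i^n=u(x_i,t_n)$, and let $U_i^n$ be the solution of the finite difference scheme $$U_i^{n+1}-\frac{K_1\tau}{2h^{\alpha}}\sum_{k=0}^{i+1}w_k^{(\alpha)}U_{i-k+1}^{n+1}-\frac{K_2\tau}{2h^{\alpha}}\sum_{k=0}^{N-i+1}w_k^{(\alpha)}U_{i+k-1}^{n+1}$$ $$=U_i^n+\frac{K_1\tau}{2h^{\alpha}}\sum_{k=0}^{i+1}w_k^{(\alpha)}U_{i-k+1}^n+\frac{K_2\tau}{2h^{\alpha}}\sum_{k=0}^{N-i+1}w_k^{(\alpha)}U_{i+k-1}^n+\tau f_i^{n+1/2},\qquad 1\le i\le N-1,\ 0\le n\le M-1,$$ with $U_i^0=u_0(x_i)$, $U_0^n=\phi_a(t_n)$, $U_N^n=\phi_b(t_n)$. Then for all $1\le n\le M$, $$\|u^n-U^n\|\le c(\tau^2+h^2),$$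 where $c$ is a positive constant (independent of $n$, $\tau$ and $h$) and $\|\cdot\|$ is the discrete $L^2$-norm.
   Context: For $1<\alpha<2$, ${}_aD_x^{\alpha}u(x)=\frac{1}{\Gamma(2-\alpha)}\frac{\mathrm{d}^2}{\mathrm{d}x^2}\int_a^x\frac{u(\xi)}{(x-\xi)^{\alpha-1}}\mathrm{d}\xi$ and ${}_xD_b^{\alpha}u(x)=\frac{1}{\Gamma(2-\alpha)}\frac{\mathrm{d}^2}{\mathrm{d}x^2}\int_x^b\frac{u(\xi)}{(\xi-x)^{\alpha-1}}\mathrm{d}\xi$ are the left and right Riemann-Liouville derivatives; for $\alpha=2$ both are the second derivative. $N,M$ are positive integers, $h=(b-a)/N$, $\tau=T/M$, $x_i=a+ih$, $t_n=n\tau$, $t_{n+1/2}=(t_n+t_{n+1})/2$, $f_i^{n+1/2}=f(x_i,t_{n+1/2})$. The discrete $L^2$-norm of a grid function $v=\{v_i\}$ with $v_0=v_N=0$ is $\|v\|=\sqrt{h\sum_{i=1}^{N-1}v_i^2}$. With $g_0^{(\alpha)}=1$, $g_k^{(\alpha)}=\left(1-\frac{\alpha+1}{k}\right)g_{k-1}^{(\alpha)}$ ($k\ge1$), the coefficients are: for $(p,q)=(1,0)$: $w_0^{(\alpha)}=\frac{\alpha}{2}g_0^{(\alpha)}$, $w_k^{(\alpha)}=\frac{\alpha}{2}g_k^{(\alpha)}+\frac{2-\alpha}{2}g_{k-1}^{(\alpha)}$ for $k\ge1$; for $(p,q)=(1,-1)$: $w_0^{(\alpha)}=\frac{2+\alpha}{4}g_0^{(\alpha)}$,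 $w_1^{(\alpha)}=\frac{2+\alpha}{4}g_1^{(\alpha)}$, $w_k^{(\alpha)}=\frac{2+\alpha}{4}g_k^{(\alpha)}+\frac{2-\alpha}{4}g_{k-2}^{(\alpha)}$ for $k\ge2$. Standing assumption: the problem has a unique and sufficiently smooth solution $u$. "Sufficiently smooth" is understood so that the scheme is consistent of second order, i.e. when the exact values $u_i^n$ are substituted for $U_i^n$ in the scheme the equation holds with an additional term $\tau\varepsilon_i^n$ on the right-hand side, where $|\varepsilon_i^n|\le\tilde c(\tau^2+h^2)$ with $\tilde c$ independent of $i,n,\tau,h$. *)

theory Defs
  imports "HOL-Analysis.Analysis"
begin

section \<open>Riemann-Liouville derivatives of order between 1 and 2\<close>

definition left_RL_integral :: "real \<Rightarrow> real \<Rightarrow> (real \<Rightarrow> real) \<Rightarrow> real \<Rightarrow> real" where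
  "left_RL_integral \<alpha> a u x = integral {a..x} (\<lambda>\<xi>. u \<xi> / (x - \<xi>) powr (\<alpha> - 1))"

definition right_RL_integral :: "real \<Rightarrow> real \<Rightarrow> (real \<Rightarrow> real) \<Rightarrow> real \<Rightarrow> real" where
  "right_RL_integral \<alpha> b u x = integral {x..b} (\<lambda>\<xi>. u \<xi> / (\<xi> - x) powr (\<alpha> - 1))"

definition left_RL_deriv :: "real \<Rightarrow> real \<Rightarrow> (real \<Rightarrow> real) \<Rightarrow> real \<Rightarrow> real" where
  "left_RL_deriv \<alpha> a u x =
     (if \<alpha> = 2 then (deriv ^^ 2) u x
      else 1 / Gamma (2 - \<alpha>) * (deriv ^^ 2) (left_RL_integral \<alpha> a u) x)"

definition right_RL_deriv :: "real \<Rightarrow> real \<Rightarrow> (real \<Rightarrow> real) \<Rightarrow> real \<Rightarrow> real" where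
  "right_RL_deriv \<alpha> b u x =
     (if \<alpha> = 2 then (deriv ^^ 2) u x
      else 1 / Gamma (2 - \<alpha>) * (deriv ^^ 2) (right_RL_integral \<alpha> b u) x)"

text \<open>Since \<^const>\<open>deriv\<close> is a total function, existence of the derivatives is a separate predicate.\<close>

definition twice_differentiable_at :: "(real \<Rightarrow> real) \<Rightarrow> real \<Rightarrow> bool" where
  "twice_differentiable_at f x \<longleftrightarrow>
     (\<forall>\<^sub>F y in nhds x. f differentiable at y) \<and> deriv f differentiable at x"

definition left_RL_differentiable_at :: "real \<Rightarrow> real \<Rightarrow> (real \<Rightarrow> real) \<Rightarrow> real \<Rightarrow> bool" where
  "left_RL_differentiable_at \<alpha> a u x \<longleftrightarrow>
     twice_differentiable_at (if \<alpha> = 2 then u else left_RL_integral \<alpha> a u) x"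

definition right_RL_differentiable_at :: "real \<Rightarrow> real \<Rightarrow> (real \<Rightarrow> real) \<Rightarrow> real \<Rightarrow> bool" where
  "right_RL_differentiable_at \<alpha> b u x \<longleftrightarrow>
     twice_differentiable_at (if \<alpha> = 2 then u else right_RL_integral \<alpha> b u) x"

section \<open>The two-sided fractional diffusion problem\<close>

text \<open>Classical solutions, continuous up to the boundary. The derivative in time is one-sided at the
  final time \<open>T\<close>. A spatial derivative is required to exist only if its coefficient
  is nonzero.\<close>

definition diffusion_solution ::
  "real \<Rightarrow> real \<Rightarrow> real \<Rightarrow> real \<Rightarrow> real \<Rightarrow> real \<Rightarrow> (real \<Rightarrow> real \<Rightarrow> real) \<Rightarrow> (real \<Rightarrow> real) \<Rightarrow>
   (real \<Rightarrow> real) \<Rightarrow> (real \<Rightarrow> real) \<Rightarrow> (real \<Rightarrow> real \<Rightarrow> real) \<Rightarrow> bool" where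
  "diffusion_solution \<alpha> K1 K2 a b T f u0 \<phi>a \<phi>b u \<longleftrightarrow>
     continuous_on ({a..b} \<times> {0..T}) (\<lambda>(x, t). u x t) \<and>
     (\<forall>x\<in>{a<..<b}. \<forall>t\<in>{0<..T}.
        (K1 \<noteq> 0 \<longrightarrow> left_RL_differentiable_at \<alpha> a (\<lambda>y. u y t) x) \<and>
        (K2 \<noteq> 0 \<longrightarrow> right_RL_differentiable_at \<alpha> b (\<lambda>y. u y t) x) \<and>
        ((\<lambda>s. u x s) has_real_derivative
           K1 * left_RL_deriv \<alpha> a (\<lambda>y. u y t) x + K2 * right_RL_deriv \<alpha> b (\<lambda>y. u y t) x + f x t)
          (at t within {0..T})) \<and>
     (\<forall>x\<in>{a..b}. u x 0 = u0 x) \<and>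
     (\<forall>t\<in>{0..T}. u a t = \<phi>a t \<and> u b t = \<phi>b t)"

definition unique_diffusion_solution ::
  "real \<Rightarrow> real \<Rightarrow> real \<Rightarrow> real \<Rightarrow> real \<Rightarrow> real \<Rightarrow> (real \<Rightarrow> real \<Rightarrow> real) \<Rightarrow> (real \<Rightarrow> real) \<Rightarrow>
   (real \<Rightarrow> real) \<Rightarrow> (real \<Rightarrow> real) \<Rightarrow> (real \<Rightarrow> real \<Rightarrow> real) \<Rightarrow> bool" where
  "unique_diffusion_solution \<alpha> K1 K2 a b T f u0 \<phi>a \<phi>b u \<longleftrightarrow>
     diffusion_solution \<alpha> K1 K2 a b T f u0 \<phi>a \<phi>b u \<and>
     (\<forall>v. diffusion_solution \<alpha> K1 K2 a b T f u0 \<phi>a \<phi>b v \<longrightarrow>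
        (\<forall>x\<in>{a..b}. \<forall>t\<in>{0..T}. v x t = u x t))"

section \<open>Weighted and shifted Gruenwald coefficients\<close>

fun grunwald_coeff :: "real \<Rightarrow> nat \<Rightarrow> real" where
  "grunwald_coeff \<alpha> 0 = 1"
| "grunwald_coeff \<alpha> (Suc k) = (1 - (\<alpha> + 1) / real (Suc k)) * grunwald_coeff \<alpha> k"

fun wsgd_coeff_1_0 :: "real \<Rightarrow> nat \<Rightarrow> real" where
  "wsgd_coeff_1_0 \<alpha> 0 = \<alpha> / 2 * grunwald_coeff \<alpha> 0"
| "wsgd_coeff_1_0 \<alpha> (Suc k) =
     \<alpha> / 2 * grunwald_coeff \<alpha> (Suc k) + (2 - \<alpha>) / 2 * grunwald_coeff \<alpha> k"

fun wsgd_coeff_1_m1 :: "real \<Rightarrow> nat \<Rightarrow> real" where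
  "wsgd_coeff_1_m1 \<alpha> 0 = (2 + \<alpha>) / 4 * grunwald_coeff \<alpha> 0"
| "wsgd_coeff_1_m1 \<alpha> (Suc 0) = (2 + \<alpha>) / 4 * grunwald_coeff \<alpha> (Suc 0)"
| "wsgd_coeff_1_m1 \<alpha> (Suc (Suc k)) =
     (2 + \<alpha>) / 4 * grunwald_coeff \<alpha> (Suc (Suc k)) + (2 - \<alpha>) / 4 * grunwald_coeff \<alpha> k"

text \<open>Only the shifts \<open>(1, 0)\<close> and \<open>(1, -1)\<close> are meaningful; other pairs get the dummy value 0.\<close>

definition wsgd_coeff :: "int \<Rightarrow> int \<Rightarrow> real \<Rightarrow> nat \<Rightarrow> real" where
  "wsgd_coeff p q \<alpha> k =
     (if (p, q) = (1, 0) then wsgd_coeff_1_0 \<alpha> k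
      else if (p, q) = (1, -1) then wsgd_coeff_1_m1 \<alpha> k
      else 0)"

section \<open>The Crank-Nicolson scheme\<close>

text \<open>In the two operators below \<open>1 \<le> i\<close> and \<open>i < N\<close>, so that none of the natural number
  subtractions in the indices truncates.\<close>

definition cn_implicit ::
  "int \<Rightarrow> int \<Rightarrow> real \<Rightarrow> real \<Rightarrow> real \<Rightarrow> nat \<Rightarrow> real \<Rightarrow> real \<Rightarrow> (nat \<Rightarrow> real) \<Rightarrow> nat \<Rightarrow> real" where
  "cn_implicit p q \<alpha> K1 K2 N h \<tau> V i =
     V i
     - K1 * \<tau> / (2 * h powr \<alpha>) * (\<Sum>k=0..i+1. wsgd_coeff p q \<alpha> k * V (i + 1 - k))
     - K2 * \<tau> / (2 * h powr \<alpha>) * (\<Sum>k=0..N-i+1. wsgd_coeff p q \<alpha> k * V (i + k - 1))"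

definition cn_explicit ::
  "int \<Rightarrow> int \<Rightarrow> real \<Rightarrow> real \<Rightarrow> real \<Rightarrow> nat \<Rightarrow> real \<Rightarrow> real \<Rightarrow> (nat \<Rightarrow> real) \<Rightarrow> nat \<Rightarrow> real" where
  "cn_explicit p q \<alpha> K1 K2 N h \<tau> V i =
     V i
     + K1 * \<tau> / (2 * h powr \<alpha>) * (\<Sum>k=0..i+1. wsgd_coeff p q \<alpha> k * V (i + 1 - k))
     + K2 * \<tau> / (2 * h powr \<alpha>) * (\<Sum>k=0..N-i+1. wsgd_coeff p q \<alpha> k * V (i + k - 1))"

text \<open>A space-time grid function \<open>U\<close> takes the time index first: \<open>U n i\<close> is the value at the
  \<open>i\<close>-th grid point in space at time level \<open>n\<close>.\<close>

definition grid_values :: "real \<Rightarrow> real \<Rightarrow> real \<Rightarrow> (real \<Rightarrow> real \<Rightarrow> real) \<Rightarrow> nat \<Rightarrow> nat \<Rightarrow> real" where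
  "grid_values a h \<tau> u n i = u (a + real i * h) (real n * \<tau>)"

definition midpoint_values :: "real \<Rightarrow> real \<Rightarrow> real \<Rightarrow> (real \<Rightarrow> real \<Rightarrow> real) \<Rightarrow> nat \<Rightarrow> nat \<Rightarrow> real" where
  "midpoint_values a h \<tau> f n i =
     f (a + real i * h) ((real n * \<tau> + real (Suc n) * \<tau>) / 2)"

definition cn_scheme_solution ::
  "int \<Rightarrow> int \<Rightarrow> real \<Rightarrow> real \<Rightarrow> real \<Rightarrow> real \<Rightarrow> real \<Rightarrow> real \<Rightarrow> (real \<Rightarrow> real \<Rightarrow> real) \<Rightarrow> (real \<Rightarrow> real) \<Rightarrow>
   (real \<Rightarrow> real) \<Rightarrow> (real \<Rightarrow> real) \<Rightarrow> nat \<Rightarrow> nat \<Rightarrow> (nat \<Rightarrow> nat \<Rightarrow> real) \<Rightarrow> bool" where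
  "cn_scheme_solution p q \<alpha> K1 K2 a b T f u0 \<phi>a \<phi>b N M U \<longleftrightarrow>
     (let h = (b - a) / real N; \<tau> = T / real M in
        (\<forall>n\<in>{0..<M}. \<forall>i\<in>{1..<N}.
           cn_implicit p q \<alpha> K1 K2 N h \<tau> (U (Suc n)) i =
           cn_explicit p q \<alpha> K1 K2 N h \<tau> (U n) i + \<tau> * midpoint_values a h \<tau> f n i) \<and>
        (\<forall>i\<in>{0..N}. U 0 i = u0 (a + real i * h)) \<and>
        (\<forall>n\<in>{0..M}. U n 0 = \<phi>a (real n * \<tau>) \<and> U n N = \<phi>b (real n * \<tau>)))"

text \<open>Second order consistency is what sufficient smoothness of the exact solution \<open>u\<close> provides:
  the constant is uniform over all grids and all grid points.\<close>

definition cn_consistent_second_order ::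
  "int \<Rightarrow> int \<Rightarrow> real \<Rightarrow> real \<Rightarrow> real \<Rightarrow> real \<Rightarrow> real \<Rightarrow> real \<Rightarrow> (real \<Rightarrow> real \<Rightarrow> real) \<Rightarrow>
   (real \<Rightarrow> real \<Rightarrow> real) \<Rightarrow> bool" where
  "cn_consistent_second_order p q \<alpha> K1 K2 a b T f u \<longleftrightarrow>
     (\<exists>c. \<forall>N>0. \<forall>M>0.
        let h = (b - a) / real N; \<tau> = T / real M; V = grid_values a h \<tau> u in
        \<exists>\<epsilon> :: nat \<Rightarrow> nat \<Rightarrow> real. \<forall>n\<in>{0..<M}. \<forall>i\<in>{1..<N}.
          cn_implicit p q \<alpha> K1 K2 N h \<tau> (V (Suc n)) i =
          cn_explicit p q \<alpha> K1 K2 N h \<tau> (V n) i + \<tau> * midpoint_values a h \<tau> f n i + \<tau> * \<epsilon> n i \<and>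
          \<bar>\<epsilon> n i\<bar> \<le> c * (\<tau>\<^sup>2 + h\<^sup>2))"

definition grid_norm :: "nat \<Rightarrow> real \<Rightarrow> (nat \<Rightarrow> real) \<Rightarrow> real" where
  "grid_norm N h v = sqrt (h * (\<Sum>i=1..N-1. (v i)\<^sup>2))"

end

theory Submission
  imports Defs
begin

text \<open>The matrix of the scheme is Toeplitz, so its quadratic form is a combination of the
  autocorrelations \<open>R j = (\<Sum>i. v i * v (i + j))\<close>, namely \<open>\<Sum>k. w k * R \<bar>k - 1\<bar>\<close>. It is nonpositive:
  the partial sums of \<open>w\<close> are nonpositive, \<open>R 0 - R j\<close> is nonnegative, and the only coefficient
  that can spoil the signs, \<open>w 3\<close> for the shift \<open>(1, -1)\<close>, is absorbed by \<open>w 0 + w 2\<close> through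
  \<open>R 0 - R 2 \<le> 4 * (R 0 - R 1)\<close>, which says that the second differences of \<open>v\<close> have a nonnegative
  sum of squares. Testing the error equation with the sum of the errors at two consecutive time
  levels then shows that the norm of the error grows by at most \<open>\<tau> * \<parallel>\<epsilon>\<parallel>\<close> per step.\<close>

section \<open>Signs and partial sums of the coefficients\<close>

lemma grunwald_coeff_2: "grunwald_coeff \<alpha> 2 = \<alpha> * (\<alpha> - 1) / 2"
  by (simp add: numeral_eq_Suc field_simps)

lemma grunwald_coeff_3: "grunwald_coeff \<alpha> 3 = \<alpha> * (\<alpha> - 1) * (2 - \<alpha>) / 6"
  by (simp add: numeral_eq_Suc field_simps)

text \<open>The coefficient at index 1 is \<open>-\<alpha>\<close>. Every recursion step leading to
  an index of at least 3 has a nonnegative factor, because \<open>\<alpha> + 1 \<le> 3\<close>, so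
  the sign at index 2 propagates.\<close>

lemma grunwald_coeff_nonneg:
  assumes "1 \<le> \<alpha>" "\<alpha> \<le> 2" "2 \<le> k"
  shows "0 \<le> grunwald_coeff \<alpha> k"
  using assms(3)
proof (induction k rule: dec_induct)
  case base
  show ?case using assms unfolding grunwald_coeff_2 by simp
next
  case (step k)
  have "\<alpha> + 1 \<le> real (Suc k)" using assms step by simp
  then have "0 \<le> 1 - (\<alpha> + 1) / real (Suc k)" by simp
  with step show ?case by (metis grunwald_coeff.simps(2) mult_nonneg_nonneg)
qed

text \<open>The coefficients are the signed binomials \<open>(-1)^k (\<alpha> choose k)\<close>,
  with partial sums \<open>(-1)^n (\<alpha> - 1 choose n)\<close>. Writing these through the next
  coefficient reduces their sign to that of a single coefficient.\<close>

lemma sum_grunwald_coeff: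
  assumes "\<alpha> \<noteq> 0"
  shows "(\<Sum>k\<le>n. grunwald_coeff \<alpha> k) = - (real (Suc n) * grunwald_coeff \<alpha> (Suc n) / \<alpha>)"
proof (induction n)
  case 0
  show ?case using assms by simp
next
  case (Suc n)
  \<comment> \<open>The recursion cleared of its denominator: adding one more coefficient to the
    closed form changes the factor \<open>Suc n\<close> into
    \<open>Suc n - \<alpha>\<close>.\<close>
  have "real (Suc (Suc n)) * grunwald_coeff \<alpha> (Suc (Suc n)) =
      (real (Suc n) - \<alpha>) * grunwald_coeff \<alpha> (Suc n)"
    unfolding grunwald_coeff.simps(2)[of \<alpha> "Suc n"] by (simp add: field_simps del: grunwald_coeff.simps)
  with Suc assms show ?case by (simp add: field_simps del: grunwald_coeff.simps)
qed

lemma sum_grunwald_coeff_nonpos: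
  assumes "1 \<le> \<alpha>" "\<alpha> \<le> 2" "1 \<le> n"
  shows "(\<Sum>k\<le>n. grunwald_coeff \<alpha> k) \<le> 0"
  using assms grunwald_coeff_nonneg[of \<alpha> "Suc n"]
  by (simp add: sum_grunwald_coeff del: grunwald_coeff.simps)

text \<open>The weights mix the Gruenwald sequence with a delayed copy of itself. Partial sums mix
  in the same way, the delayed one being shorter.\<close>

lemma sum_wsgd_coeff_1_0:
  "(\<Sum>k\<le>Suc n. wsgd_coeff_1_0 \<alpha> k) =
     \<alpha> / 2 * (\<Sum>k\<le>Suc n. grunwald_coeff \<alpha> k) + (2 - \<alpha>) / 2 * (\<Sum>k\<le>n. grunwald_coeff \<alpha> k)"
  by (induction n) (simp_all add: algebra_simps del: grunwald_coeff.simps(2))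

lemma sum_wsgd_coeff_1_m1:
  "(\<Sum>k\<le>Suc (Suc n). wsgd_coeff_1_m1 \<alpha> k) =
     (2 + \<alpha>) / 4 * (\<Sum>k\<le>Suc (Suc n). grunwald_coeff \<alpha> k)
     + (2 - \<alpha>) / 4 * (\<Sum>k\<le>n. grunwald_coeff \<alpha> k)"
  unfolding sum.atMost_Suc_shift
  by (simp add: sum.distrib sum_distrib_left distrib_left del: grunwald_coeff.simps(2))

text \<open>\<open>w 0\<close> and \<open>w 2\<close> both multiply the autocorrelation at lag 1, so
  only their sum needs a sign. The partial sums start at 3 because for \<open>(1, -1)\<close> the
  copy delayed by two must contain at least two terms; the sum up to 2 can be positive.\<close>

definition stable_coeffs :: "(nat \<Rightarrow> real) \<Rightarrow> bool" where
  "stable_coeffs w \<longleftrightarrow>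
     0 \<le> w 0 + w 2 \<and> 0 \<le> w 0 + w 2 + 4 * w 3 \<and> (\<forall>k\<ge>4. 0 \<le> w k) \<and> (\<forall>n\<ge>3. (\<Sum>k\<le>n. w k) \<le> 0)"

lemma stable_coeffs_1_0:
  assumes "1 \<le> \<alpha>" "\<alpha> \<le> 2"
  shows "stable_coeffs (wsgd_coeff_1_0 \<alpha>)"
proof -
  have nonneg: "0 \<le> wsgd_coeff_1_0 \<alpha> k" if "3 \<le> k" for k
  proof -
    obtain j where j: "k = Suc j" "2 \<le> j" using \<open>3 \<le> k\<close> by (cases k) auto
    show ?thesis
      using assms j grunwald_coeff_nonneg[of \<alpha> j] grunwald_coeff_nonneg[of \<alpha> "Suc j"]
      by (simp del: grunwald_coeff.simps)
  qed
  \<comment> \<open>\<open>w 2\<close> alone is negative for \<open>\<alpha>\<close> near 1. The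
    factored sum vanishes at \<open>\<alpha> = 1\<close> and is visibly nonnegative beyond.\<close>
  have "wsgd_coeff_1_0 \<alpha> 0 + wsgd_coeff_1_0 \<alpha> 2 = \<alpha> * ((\<alpha> - 1) * (\<alpha> + 2)) / 4"
    using grunwald_coeff_2[of \<alpha>] by (simp add: numeral_eq_Suc) (simp add: field_simps)
  moreover have "0 \<le> \<alpha> * ((\<alpha> - 1) * (\<alpha> + 2)) / 4" using assms by simp
  ultimately have "0 \<le> wsgd_coeff_1_0 \<alpha> 0 + wsgd_coeff_1_0 \<alpha> 2" by simp
  moreover have "(\<Sum>k\<le>n. wsgd_coeff_1_0 \<alpha> k) \<le> 0" if "3 \<le> n" for n
  proof -
    obtain m where m: "n = Suc m" "1 \<le> m" using \<open>3 \<le> n\<close> by (cases n) auto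
    have "\<alpha> / 2 * (\<Sum>k\<le>Suc m. grunwald_coeff \<alpha> k) \<le> 0"
      "(2 - \<alpha>) / 2 * (\<Sum>k\<le>m. grunwald_coeff \<alpha> k) \<le> 0"
      using assms m by (intro mult_nonneg_nonpos sum_grunwald_coeff_nonpos; simp)+
    then show ?thesis unfolding m(1) sum_wsgd_coeff_1_0 by linarith
  qed
  ultimately show ?thesis using nonneg[of 3] nonneg by (simp add: stable_coeffs_def)
qed

text \<open>Here \<open>w 3\<close> is negative for \<open>\<alpha> < 2\<close> apart from no
  exception at \<open>\<alpha> = 1\<close>. It is controlled by \<open>w 0 + w 2 \<ge> 1\<close> and
  \<open>4 * w 3 \<ge> -1\<close>.\<close>

lemma stable_coeffs_1_m1:
  assumes "1 \<le> \<alpha>" "\<alpha> \<le> 2"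
  shows "stable_coeffs (wsgd_coeff_1_m1 \<alpha>)"
proof -
  let ?w = "wsgd_coeff_1_m1 \<alpha>"
  have nonneg: "0 \<le> ?w k" if "4 \<le> k" for k
  proof -
    obtain j where j: "k = Suc (Suc j)" "2 \<le> j"
      using \<open>4 \<le> k\<close> by (metis Suc_le_mono add_2_eq_Suc le_Suc_ex numeral_Bit0 add.assoc le_add1)
    show ?thesis
      using assms j grunwald_coeff_nonneg[of \<alpha> j] grunwald_coeff_nonneg[of \<alpha> "Suc (Suc j)"]
      by (simp del: grunwald_coeff.simps)
  qed
  have w02: "?w 0 + ?w 2 = 1 + \<alpha> * (\<alpha> - 1) * (2 + \<alpha>) / 8"
    using grunwald_coeff_2[of \<alpha>] by (simp add: numeral_eq_Suc) (simp add: field_simps)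
  have w3: "4 * ?w 3 = - (\<alpha> * (2 - \<alpha>) * (8 - \<alpha> - \<alpha> * \<alpha>) / 6)"
    using grunwald_coeff_3[of \<alpha>] by (simp add: numeral_eq_Suc) (simp add: field_simps)
  have ge1: "1 \<le> ?w 0 + ?w 2" unfolding w02 using assms by simp
  \<comment> \<open>The first factor is \<open>1 - (\<alpha> - 1)^2\<close>; the second lies between
    2 and 6 on \<open>[1, 2]\<close>.\<close>
  have "\<alpha> * (2 - \<alpha>) * (8 - \<alpha> - \<alpha> * \<alpha>) \<le> 1 * 6"
  proof (rule mult_mono)
    show "\<alpha> * (2 - \<alpha>) \<le> 1" using zero_le_square[of "\<alpha> - 1"] by (simp add: algebra_simps)
    have "1 * 1 \<le> \<alpha> * \<alpha>" "\<alpha> * \<alpha> \<le> 2 * 2" using assms by (intro mult_mono; simp)+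
    then show "8 - \<alpha> - \<alpha> * \<alpha> \<le> 6" "0 \<le> 8 - \<alpha> - \<alpha> * \<alpha>" using assms by linarith+
  qed simp
  then have "0 \<le> ?w 0 + ?w 2 + 4 * ?w 3" using ge1 w3 by linarith
  moreover have "(\<Sum>k\<le>n. ?w k) \<le> 0" if "3 \<le> n" for n
  proof -
    obtain m where m: "n = Suc (Suc m)" "1 \<le> m"
      using \<open>3 \<le> n\<close> by (metis One_nat_def Suc_le_D Suc_le_mono numeral_3_eq_3)
    have "(2 + \<alpha>) / 4 * (\<Sum>k\<le>Suc (Suc m). grunwald_coeff \<alpha> k) \<le> 0"
      "(2 - \<alpha>) / 4 * (\<Sum>k\<le>m. grunwald_coeff \<alpha> k) \<le> 0"
      using assms m by (intro mult_nonneg_nonpos sum_grunwald_coeff_nonpos; simp)+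
    then show ?thesis unfolding m(1) sum_wsgd_coeff_1_m1 by linarith
  qed
  ultimately show ?thesis using ge1 nonneg by (simp add: stable_coeffs_def)
qed

lemma stable_coeffs_wsgd:
  assumes "1 \<le> \<alpha>" "\<alpha> \<le> 2" "(p, q) \<in> {(1, 0), (1, -1)}"
  shows "stable_coeffs (wsgd_coeff p q \<alpha>)"
proof -
  have "wsgd_coeff p q \<alpha> = wsgd_coeff_1_0 \<alpha> \<or> wsgd_coeff p q \<alpha> = wsgd_coeff_1_m1 \<alpha>"
    using assms(3) by (auto simp: wsgd_coeff_def fun_eq_iff)
  then show ?thesis using stable_coeffs_1_0 stable_coeffs_1_m1 assms by auto
qed

section \<open>The quadratic form of the scheme\<close>

definition autocorr :: "nat \<Rightarrow> (nat \<Rightarrow> real) \<Rightarrow> nat \<Rightarrow> real" where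
  "autocorr N v j = (\<Sum>i\<le>N. v i * v (i + j))"

text \<open>Zero boundary values, extended by zero beyond \<open>N\<close>: sums with shifted
  indices can then be lengthened without changing their value.\<close>

locale grid_vector =
  fixes N :: nat and v :: "nat \<Rightarrow> real"
  assumes zero_left: "v 0 = 0" and zero_right: "\<And>i. N \<le> i \<Longrightarrow> v i = 0"
begin

text \<open>Truncated subtraction is harmless here, as it hits the boundary value \<open>v 0 = 0\<close>.\<close>

lemma autocorr_backward: "(\<Sum>i\<le>N. v i * v (i - j)) = autocorr N v j"
  unfolding autocorr_def
\<comment> \<open>The shift by \<open>j\<close> is a bijection only away from the indices in
  \<open>S'\<close> and \<open>T'\<close>, where the summands vanish.\<close>
proof (rule sum.reindex_bij_witness_not_neutral
    [where S' = "{i. i \<le> N \<and> i \<le> j}" and T' = "{i. i \<le> N \<and> (i = 0 \<or> N < i + j)}"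
      and i = "\<lambda>i. i + j" and j = "\<lambda>i. i - j"])
qed (auto simp: zero_left zero_right, metis diff_is_0_eq' le_add_diff_inverse2 nle_le zero_left)

lemma sum_square_shift_le: "(\<Sum>i\<le>N. (v (i + j))\<^sup>2) \<le> autocorr N v 0"
proof -
  have "(\<Sum>i\<le>N. (v (i + j))\<^sup>2) = (\<Sum>i\<in>(\<lambda>i. i + j) ` {..N}. (v i)\<^sup>2)"
    by (simp add: sum.reindex)
  also have "\<dots> = (\<Sum>i\<in>(\<lambda>i. i + j) ` {..N} \<inter> {..N}. (v i)\<^sup>2)"
    by (intro sum.mono_neutral_right) (auto, metis nle_le zero_right)
  also have "\<dots> \<le> (\<Sum>i\<le>N. (v i)\<^sup>2)"
    by (intro sum_mono2) auto
  finally show ?thesis by (simp add: autocorr_def power2_eq_square)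
qed

lemma autocorr_le: "autocorr N v j \<le> autocorr N v 0"
proof -
  have "2 * autocorr N v j \<le> (\<Sum>i\<le>N. (v i)\<^sup>2 + (v (i + j))\<^sup>2)"
    unfolding autocorr_def sum_distrib_left
    by (intro sum_mono) (metis mult.assoc sum_squares_bound)
  also have "\<dots> = autocorr N v 0 + (\<Sum>i\<le>N. (v (i + j))\<^sup>2)"
    by (simp add: sum.distrib autocorr_def power2_eq_square)
  finally show ?thesis using sum_square_shift_le[of j] by linarith
qed

lemma autocorr_second_diff:
  "autocorr N v 0 - autocorr N v 2 \<le> 4 * (autocorr N v 0 - autocorr N v 1)"
proof -
  \<comment> \<open>Shifting the products by one index loses only the term with \<open>v 0\<close>
    and gains only terms beyond the grid.\<close>
  have v1: "(\<Sum>i\<le>N. v (i + 1) * v (i + 2)) = autocorr N v 1"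
    using sum.atMost_Suc_shift[of "\<lambda>i. v i * v (i + 1)" N]
    by (simp add: autocorr_def zero_left zero_right)
  have "0 \<le> (\<Sum>i\<le>N. (v i - 2 * v (i + 1) + v (i + 2))\<^sup>2)"
    by (intro sum_nonneg) simp
  also have "\<dots> = (\<Sum>i\<le>N. v i * v i) + 4 * (\<Sum>i\<le>N. (v (i + 1))\<^sup>2) + (\<Sum>i\<le>N. (v (i + 2))\<^sup>2)
      - 4 * autocorr N v 1 - 4 * (\<Sum>i\<le>N. v (i + 1) * v (i + 2)) + 2 * autocorr N v 2"
    unfolding autocorr_def sum_distrib_left sum.distrib[symmetric] sum_subtractf[symmetric]
    by (intro sum.cong) (auto simp: power2_eq_square algebra_simps)
  finally show ?thesis
    using v1 sum_square_shift_le[of 1] sum_square_shift_le[of 2] by (simp add: autocorr_def)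
qed

text \<open>With \<open>E j = R 0 - R j\<close> the form is \<open>R 0\<close> times a partial sum
  of \<open>w\<close>, minus the same form in \<open>E\<close>. The first term is nonpositive and
  the second form nonnegative.\<close>

lemma toeplitz_form_nonpos:
  assumes w: "stable_coeffs w" and K: "3 \<le> K"
  shows "w 0 * autocorr N v 1 + (\<Sum>j<K. w (Suc j) * autocorr N v j) \<le> 0"
proof -
  let ?R = "autocorr N v"
  define E where "E j = ?R 0 - ?R j" for j
  have E: "0 \<le> E j" "E 0 = 0" "E 2 \<le> 4 * E 1" for j
    using autocorr_le autocorr_second_diff by (simp_all add: E_def)
  obtain m where m: "K = m + 3" using K by (metis add.commute le_Suc_ex)
  have "0 \<le> (w 0 + w 2) * E 1 + w 3 * E 2"
  proof (cases "0 \<le> w 3")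
    case True
    then show ?thesis using w E by (simp add: stable_coeffs_def)
  next
    case False
    \<comment> \<open>A negative \<open>w 3\<close> calls for an upper bound on \<open>E 2\<close>;
      this is where the factor 4 in \<open>stable_coeffs\<close> comes from.\<close>
    then have "w 3 * (4 * E 1) \<le> w 3 * E 2" using E by (intro mult_left_mono_neg) auto
    moreover have "0 \<le> (w 0 + w 2 + 4 * w 3) * E 1" using w E by (simp add: stable_coeffs_def)
    ultimately show ?thesis by (simp add: algebra_simps)
  qed
  moreover have "0 \<le> (\<Sum>j<m. w (j + 4) * E (j + 3))"
    using w E by (intro sum_nonneg) (simp add: stable_coeffs_def)
  \<comment> \<open>The coefficient \<open>w 1\<close> drops out because
    \<open>E 0 = 0\<close>.\<close>
  moreover have "(\<Sum>j<K. w (Suc j) * E j) = w 2 * E 1 + w 3 * E 2 + (\<Sum>j<m. w (j + 4) * E (j + 3))"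
    unfolding m by (induction m) (simp_all add: numeral_eq_Suc E)
  ultimately have "0 \<le> w 0 * E 1 + (\<Sum>j<K. w (Suc j) * E j)" by (simp add: algebra_simps)
  moreover have "(\<Sum>k\<le>K. w k) * ?R 0 \<le> 0"
    using w K by (intro mult_nonpos_nonneg)
      (simp_all add: stable_coeffs_def autocorr_def sum_nonneg)
  moreover have "(\<Sum>k\<le>K. w k) = w 0 + (\<Sum>j<K. w (Suc j))"
    by (simp add: sum.atMost_shift)
  ultimately show ?thesis
    by (simp add: E_def algebra_simps sum_subtractf sum_distrib_left sum_distrib_right)
qed

text \<open>Lengthening all inner sums to one common limit allows the sums to be swapped, leaving
  one autocorrelation per coefficient. The added terms contain \<open>v 0\<close>, since the
  subtraction truncates there.\<close>

lemma left_form_nonpos: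
  assumes "stable_coeffs w"
  shows "(\<Sum>i\<in>{1..<N}. v i * (\<Sum>k=0..i+1. w k * v (i + 1 - k))) \<le> 0"
proof -
  let ?K = "N + 3"
  have "(\<Sum>k=0..i+1. w k * v (i + 1 - k)) = (\<Sum>k\<le>?K. w k * v (i + 1 - k))" if "i < N" for i
    using that by (intro sum.mono_neutral_left) (auto simp: zero_left)
  then have "(\<Sum>i\<in>{1..<N}. v i * (\<Sum>k=0..i+1. w k * v (i + 1 - k)))
      = (\<Sum>i\<in>{1..<N}. v i * (\<Sum>k\<le>?K. w k * v (i + 1 - k)))"
    by (intro sum.cong) auto
  also have "\<dots> = (\<Sum>i\<le>N. v i * (\<Sum>k\<le>?K. w k * v (i + 1 - k)))"
  proof (intro sum.mono_neutral_left ballI)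
    fix i assume "i \<in> {..N} - {1..<N}"
    then have "i = 0 \<or> N \<le> i" by auto
    then show "v i * (\<Sum>k\<le>?K. w k * v (i + 1 - k)) = 0" by (auto simp: zero_left zero_right)
  qed auto
  also have "\<dots> = (\<Sum>k\<le>?K. w k * (\<Sum>i\<le>N. v i * v (i + 1 - k)))"
    unfolding sum_distrib_left by (subst sum.swap) (simp add: ac_simps)
  also have "\<dots> = w 0 * autocorr N v 1 + (\<Sum>j<?K. w (Suc j) * autocorr N v j)"
    unfolding sum.atMost_shift[of _ ?K] by (simp add: autocorr_backward) (simp add: autocorr_def)
  also have "\<dots> \<le> 0" using assms by (intro toeplitz_form_nonpos) auto
  finally show ?thesis .
qed

text \<open>The transposed matrix has the same quadratic form. Now the added terms lie beyond the
  grid, and only \<open>k = 0\<close> looks backward.\<close>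

lemma right_form_nonpos:
  assumes "stable_coeffs w"
  shows "(\<Sum>i\<in>{1..<N}. v i * (\<Sum>k=0..N-i+1. w k * v (i + k - 1))) \<le> 0"
proof -
  let ?K = "N + 3"
  have "(\<Sum>k=0..N-i+1. w k * v (i + k - 1)) = (\<Sum>k\<le>?K. w k * v (i + k - 1))" if "i < N" for i
    using that by (intro sum.mono_neutral_left) (auto simp: zero_right)
  then have "(\<Sum>i\<in>{1..<N}. v i * (\<Sum>k=0..N-i+1. w k * v (i + k - 1)))
      = (\<Sum>i\<in>{1..<N}. v i * (\<Sum>k\<le>?K. w k * v (i + k - 1)))"
    by (intro sum.cong) auto
  also have "\<dots> = (\<Sum>i\<le>N. v i * (\<Sum>k\<le>?K. w k * v (i + k - 1)))"
  proof (intro sum.mono_neutral_left ballI)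
    fix i assume "i \<in> {..N} - {1..<N}"
    then have "i = 0 \<or> N \<le> i" by auto
    then show "v i * (\<Sum>k\<le>?K. w k * v (i + k - 1)) = 0" by (auto simp: zero_left zero_right)
  qed auto
  also have "\<dots> = (\<Sum>k\<le>?K. w k * (\<Sum>i\<le>N. v i * v (i + k - 1)))"
    unfolding sum_distrib_left by (subst sum.swap) (simp add: ac_simps)
  also have "\<dots> = w 0 * autocorr N v 1 + (\<Sum>j<?K. w (Suc j) * autocorr N v j)"
    unfolding sum.atMost_shift[of _ ?K] using autocorr_backward[of 1] by (simp add: autocorr_def)
  also have "\<dots> \<le> 0" using assms by (intro toeplitz_form_nonpos) auto
  finally show ?thesis .
qed

end

section \<open>Stability and convergence\<close>

text \<open>The left side of the hypothesis is the difference of the squared norms. Cauchy-Schwarz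
  and the triangle inequality bound the right side, and the sum of the two norms cancels.\<close>

lemma L2_set_energy_step:
  fixes d e r :: "'a \<Rightarrow> real"
  assumes "(\<Sum>i\<in>A. (d i + e i) * (d i - e i)) \<le> (\<Sum>i\<in>A. (d i + e i) * r i)"
  shows "L2_set d A \<le> L2_set e A + L2_set r A"
proof -
  let ?D = "L2_set d A" and ?E = "L2_set e A" and ?R = "L2_set r A"
  have "?D\<^sup>2 - ?E\<^sup>2 = (\<Sum>i\<in>A. (d i + e i) * (d i - e i))"
    by (simp add: L2_set_def sum_nonneg sum_subtractf[symmetric] power2_eq_square algebra_simps)
  also have "\<dots> \<le> (\<Sum>i\<in>A. \<bar>d i + e i\<bar> * \<bar>r i\<bar>)"
    using assms by (rule order_trans) (auto intro!: sum_mono simp: abs_mult[symmetric])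
  also have "\<dots> \<le> L2_set (\<lambda>i. d i + e i) A * ?R" by (rule L2_set_mult_ineq)
  also have "\<dots> \<le> (?D + ?E) * ?R"
    by (intro mult_right_mono L2_set_triangle_ineq L2_set_nonneg)
  finally have "(?D + ?E) * (?D - ?E) \<le> (?D + ?E) * ?R" by (simp add: power2_eq_square algebra_simps)
  moreover have "0 \<le> ?D" "0 \<le> ?E" "0 \<le> ?R" by (rule L2_set_nonneg)+
  \<comment> \<open>If the sum of the norms is zero, nothing can be cancelled, but then the norm of
    \<open>d\<close> is zero.\<close>
  ultimately show ?thesis by (cases "0 < ?D + ?E") (simp, linarith)
qed

lemma cn_stability_step:
  assumes w: "stable_coeffs (wsgd_coeff p q \<alpha>)"
    and nonneg: "0 \<le> K1" "0 \<le> K2" "0 \<le> \<tau>"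
    and bdry: "d 0 = 0" "d N = 0" "e 0 = 0" "e N = 0"
    and eq: "\<And>i. i \<in> {1..<N} \<Longrightarrow>
      cn_implicit p q \<alpha> K1 K2 N h \<tau> d i = cn_explicit p q \<alpha> K1 K2 N h \<tau> e i + r i"
  shows "L2_set d {1..<N} \<le> L2_set e {1..<N} + L2_set r {1..<N}"
proof (rule L2_set_energy_step)
  define c1 c2 where "c1 = K1 * \<tau> / (2 * h powr \<alpha>)" and "c2 = K2 * \<tau> / (2 * h powr \<alpha>)"
  \<comment> \<open>Beyond \<open>N\<close> the functions \<open>d\<close> and \<open>e\<close> are
    arbitrary, so their sum is cut off to obtain a \<open>grid_vector\<close>.\<close>
  define s where "s i = (if i < N then d i + e i else 0)" for i
  let ?w = "wsgd_coeff p q \<alpha>"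
  let ?A = "\<lambda>i. \<Sum>k=0..i+1. ?w k * s (i + 1 - k)" and ?B = "\<lambda>i. \<Sum>k=0..N-i+1. ?w k * s (i + k - 1)"
  interpret grid_vector N s by standard (simp_all add: s_def bdry)
  have s: "s i = d i + e i" if "i \<le> N" for i
    using that bdry by (cases "i = N") (auto simp: s_def)
  \<comment> \<open>Both sides of the scheme apply the same spatial operator, with opposite signs,
    so the increment \<open>d - e\<close> involves it only at the sum \<open>s\<close>.\<close>
  have diff: "d i - e i = c1 * ?A i + c2 * ?B i + r i" if "i \<in> {1..<N}" for i
  proof -
    have "?A i = (\<Sum>k=0..i+1. ?w k * d (i + 1 - k)) + (\<Sum>k=0..i+1. ?w k * e (i + 1 - k))"
      unfolding sum.distrib[symmetric] using that
      by (intro sum.cong) (auto simp: s algebra_simps)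
    moreover have "?B i = (\<Sum>k=0..N-i+1. ?w k * d (i + k - 1)) + (\<Sum>k=0..N-i+1. ?w k * e (i + k - 1))"
      unfolding sum.distrib[symmetric] using that
      by (intro sum.cong) (auto simp: s algebra_simps)
    ultimately show ?thesis
      using eq[OF that] unfolding cn_implicit_def cn_explicit_def c1_def[symmetric] c2_def[symmetric]
      by (simp add: distrib_left del: One_nat_def)
  qed
  have "(\<Sum>i\<in>{1..<N}. (d i + e i) * (d i - e i)) =
      (\<Sum>i\<in>{1..<N}. s i * (c1 * ?A i + c2 * ?B i + r i))"
    by (intro sum.cong) (simp_all only: diff, simp add: s)
  also have "\<dots> = c1 * (\<Sum>i\<in>{1..<N}. s i * ?A i) + c2 * (\<Sum>i\<in>{1..<N}. s i * ?B i)
      + (\<Sum>i\<in>{1..<N}. s i * r i)"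
    unfolding sum_distrib_left[of _ _ "{1..<N}"] sum.distrib[symmetric]
    by (intro sum.cong refl) (simp only: algebra_simps)
  also have "\<dots> \<le> (\<Sum>i\<in>{1..<N}. s i * r i)"
  proof -
    have "0 \<le> c1" "0 \<le> c2" using nonneg by (simp_all add: c1_def c2_def)
    then have "c1 * (\<Sum>i\<in>{1..<N}. s i * ?A i) \<le> 0" "c2 * (\<Sum>i\<in>{1..<N}. s i * ?B i) \<le> 0"
      using left_form_nonpos[OF w] right_form_nonpos[OF w] by (auto intro: mult_nonneg_nonpos)
    then show ?thesis by linarith
  qed
  also have "\<dots> = (\<Sum>i\<in>{1..<N}. (d i + e i) * r i)"
    by (intro sum.cong) (auto simp: s)
  finally show "(\<Sum>i\<in>{1..<N}. (d i + e i) * (d i - e i)) \<le> (\<Sum>i\<in>{1..<N}. (d i + e i) * r i)" .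
qed

lemma cn_implicit_diff:
  "cn_implicit p q \<alpha> K1 K2 N h \<tau> (\<lambda>i. V i - W i) i =
     cn_implicit p q \<alpha> K1 K2 N h \<tau> V i - cn_implicit p q \<alpha> K1 K2 N h \<tau> W i"
  unfolding cn_implicit_def by (simp add: right_diff_distrib sum_subtractf)

lemma cn_explicit_diff:
  "cn_explicit p q \<alpha> K1 K2 N h \<tau> (\<lambda>i. V i - W i) i =
     cn_explicit p q \<alpha> K1 K2 N h \<tau> V i - cn_explicit p q \<alpha> K1 K2 N h \<tau> W i"
  unfolding cn_explicit_def by (simp add: right_diff_distrib sum_subtractf)

lemma L2_set_le_const:
  assumes "\<And>i. i \<in> A \<Longrightarrow> \<bar>r i\<bar> \<le> B" "0 \<le> B"
  shows "L2_set r A \<le> sqrt (real (card A)) * B"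
proof -
  have "(\<Sum>i\<in>A. (r i)\<^sup>2) \<le> real (card A) * B\<^sup>2"
    using assms by (intro sum_bounded_above) (metis abs_le_square_iff abs_of_nonneg)
  then have "L2_set r A \<le> sqrt (real (card A) * B\<^sup>2)" unfolding L2_set_def by simp
  also have "\<dots> = sqrt (real (card A)) * B" using assms(2) by (simp add: real_sqrt_mult)
  finally show ?thesis .
qed

lemma grid_norm_L2_set: "grid_norm N h v = sqrt h * L2_set v {1..<N}"
proof -
  have "{1..N - 1} = {1..<N}" by auto
  then show ?thesis by (simp add: grid_norm_def L2_set_def real_sqrt_mult)
qed

text \<open>The stability step is iterated from zero initial error. The weight \<open>sqrt h\<close>
  enters only at the end, and \<open>sqrt (real N * h)\<close> bounds the grid norm of the constant
  1.\<close>

lemma cn_error_bound: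
  assumes w: "stable_coeffs (wsgd_coeff p q \<alpha>)"
    and nonneg: "0 \<le> K1" "0 \<le> K2" "0 \<le> \<tau>" "0 \<le> h" "0 \<le> \<delta>"
    and init: "\<And>i. i \<le> N \<Longrightarrow> e 0 i = 0"
    and bdry: "\<And>n. n \<le> M \<Longrightarrow> e n 0 = 0 \<and> e n N = 0"
    and eq: "\<And>n i. n < M \<Longrightarrow> i \<in> {1..<N} \<Longrightarrow>
      cn_implicit p q \<alpha> K1 K2 N h \<tau> (e (Suc n)) i = cn_explicit p q \<alpha> K1 K2 N h \<tau> (e n) i + \<tau> * \<epsilon> n i"
    and eps: "\<And>n i. n < M \<Longrightarrow> i \<in> {1..<N} \<Longrightarrow> \<bar>\<epsilon> n i\<bar> \<le> \<delta>"
    and n: "n \<le> M"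
  shows "grid_norm N h (e n) \<le> real n * \<tau> * (sqrt (real N * h) * \<delta>)"
proof -
  have "L2_set (e n) {1..<N} \<le> real n * (sqrt (real N) * (\<tau> * \<delta>))"
    using n
  proof (induction n)
    case 0
    have "L2_set (e 0) {1..<N} = 0" by (simp add: L2_set_eq_0_iff init)
    then show ?case by simp
  next
    case (Suc n)
    have "L2_set (e (Suc n)) {1..<N} \<le> L2_set (e n) {1..<N} + L2_set (\<lambda>i. \<tau> * \<epsilon> n i) {1..<N}"
      using Suc.prems bdry[of n] bdry[of "Suc n"] nonneg
      by (intro cn_stability_step[OF w, where ?K1.0 = K1 and ?K2.0 = K2 and h = h and \<tau> = \<tau>] eq) auto
    also have "L2_set (\<lambda>i. \<tau> * \<epsilon> n i) {1..<N} \<le> sqrt (real (card {1..<N})) * (\<tau> * \<delta>)"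
      using Suc.prems nonneg eps by (intro L2_set_le_const) (auto simp: abs_mult mult_left_mono)
    also have "\<dots> \<le> sqrt (real N) * (\<tau> * \<delta>)"
      using nonneg by (intro mult_right_mono) auto
    finally show ?case using Suc by (simp add: algebra_simps)
  qed
  then have "sqrt h * L2_set (e n) {1..<N} \<le> sqrt h * (real n * (sqrt (real N) * (\<tau> * \<delta>)))"
    using nonneg by (intro mult_left_mono) auto
  then show ?thesis by (simp add: grid_norm_L2_set real_sqrt_mult ac_simps)
qed

theorem theorem5:
  fixes \<alpha> K1 K2 a b T :: real
    and p q :: int
    and f u :: "real \<Rightarrow> real \<Rightarrow> real"
    and u0 \<phi>a \<phi>b :: "real \<Rightarrow> real"
  assumes "1 < \<alpha>" and "\<alpha> \<le> 2"
    and "0 \<le> K1" and "0 \<le> K2" and "K1\<^sup>2 + K2\<^sup>2 \<noteq> 0"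
    and "(p, q) \<in> {(1, 0), (1, -1)}"
    and "a < b" and "0 < T"
    and "K1 \<noteq> 0 \<Longrightarrow> \<forall>t\<in>{0..T}. \<phi>a t = 0"
    and "K2 \<noteq> 0 \<Longrightarrow> \<forall>t\<in>{0..T}. \<phi>b t = 0"
    and "unique_diffusion_solution \<alpha> K1 K2 a b T f u0 \<phi>a \<phi>b u"
    and "cn_consistent_second_order p q \<alpha> K1 K2 a b T f u"
  shows "\<exists>c>0. \<forall>N>0. \<forall>M>0. \<forall>U.
           cn_scheme_solution p q \<alpha> K1 K2 a b T f u0 \<phi>a \<phi>b N M U \<longrightarrow>
           (\<forall>n\<in>{1..M}.
              grid_norm N ((b - a) / real N)
                (\<lambda>i. grid_values a ((b - a) / real N) (T / real M) u n i - U n i)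
              \<le> c * ((T / real M)\<^sup>2 + ((b - a) / real N)\<^sup>2))"
proof -
  obtain c where consistent: "\<And>N M. 0 < N \<Longrightarrow> 0 < M \<Longrightarrow>
      let h = (b - a) / real N; \<tau> = T / real M; V = grid_values a h \<tau> u in
        \<exists>\<epsilon> :: nat \<Rightarrow> nat \<Rightarrow> real. \<forall>n\<in>{0..<M}. \<forall>i\<in>{1..<N}.
          cn_implicit p q \<alpha> K1 K2 N h \<tau> (V (Suc n)) i =
          cn_explicit p q \<alpha> K1 K2 N h \<tau> (V n) i + \<tau> * midpoint_values a h \<tau> f n i + \<tau> * \<epsilon> n i \<and>
          \<bar>\<epsilon> n i\<bar> \<le> c * (\<tau>\<^sup>2 + h\<^sup>2)"
    using assms(12) unfolding cn_consistent_second_order_def by blast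
  have sol: "\<And>x. x \<in> {a..b} \<Longrightarrow> u x 0 = u0 x"
    "\<And>t. t \<in> {0..T} \<Longrightarrow> u a t = \<phi>a t \<and> u b t = \<phi>b t"
    using assms(11) unfolding unique_diffusion_solution_def diffusion_solution_def by blast+
  have w: "stable_coeffs (wsgd_coeff p q \<alpha>)"
    using assms by (intro stable_coeffs_wsgd) auto
  \<comment> \<open>\<open>T\<close> bounds the elapsed time and \<open>sqrt (b - a)\<close> the
    norm of the constant 1. The absolute value is there because \<open>c\<close> comes without a
    sign; the 1 makes \<open>C\<close> positive.\<close>
  define C where "C = T * (sqrt (b - a) * \<bar>c\<bar>) + 1"
  have C: "0 < C" using assms by (simp add: C_def add_nonneg_pos)
  have bound: "grid_norm N ((b - a) / real N)
        (\<lambda>i. grid_values a ((b - a) / real N) (T / real M) u n i - U n i)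
      \<le> C * ((T / real M)\<^sup>2 + ((b - a) / real N)\<^sup>2)"
    if NM: "0 < N" "0 < M" and U: "cn_scheme_solution p q \<alpha> K1 K2 a b T f u0 \<phi>a \<phi>b N M U"
      and n: "n \<in> {1..M}" for N M U n
  proof -
    define h \<tau> where "h = (b - a) / real N" and "\<tau> = T / real M"
    have pos: "0 < h" "0 < \<tau>" and Nh: "real N * h = b - a" and M\<tau>: "real M * \<tau> = T"
      using NM assms by (simp_all add: h_def \<tau>_def)
    define V where "V = grid_values a h \<tau> u"
    define e where "e n i = V n i - U n i" for n i
    define \<delta> where "\<delta> = \<bar>c\<bar> * (\<tau>\<^sup>2 + h\<^sup>2)"
    obtain \<epsilon> where \<epsilon>: "\<And>n i. n < M \<Longrightarrow> i \<in> {1..<N} \<Longrightarrow>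
          cn_implicit p q \<alpha> K1 K2 N h \<tau> (V (Suc n)) i =
          cn_explicit p q \<alpha> K1 K2 N h \<tau> (V n) i + \<tau> * midpoint_values a h \<tau> f n i + \<tau> * \<epsilon> n i \<and>
          \<bar>\<epsilon> n i\<bar> \<le> c * (\<tau>\<^sup>2 + h\<^sup>2)"
      using consistent[OF NM] unfolding Let_def h_def \<tau>_def V_def by fastforce
    have scheme: "\<And>n i. n < M \<Longrightarrow> i \<in> {1..<N} \<Longrightarrow>
           cn_implicit p q \<alpha> K1 K2 N h \<tau> (U (Suc n)) i =
           cn_explicit p q \<alpha> K1 K2 N h \<tau> (U n) i + \<tau> * midpoint_values a h \<tau> f n i"
      and U0: "\<And>i. i \<le> N \<Longrightarrow> U 0 i = u0 (a + real i * h)"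
      and Ub: "\<And>n. n \<le> M \<Longrightarrow> U n 0 = \<phi>a (real n * \<tau>) \<and> U n N = \<phi>b (real n * \<tau>)"
      using U unfolding cn_scheme_solution_def Let_def h_def \<tau>_def by auto
    have "grid_norm N h (e n) \<le> real n * \<tau> * (sqrt (real N * h) * \<delta>)"
    proof (rule cn_error_bound[OF w, where M = M and \<epsilon> = \<epsilon>])
      fix i assume "i \<le> N"
      then have "real i * h \<le> real N * h" using pos by (intro mult_right_mono) auto
      then have "a + real i * h \<in> {a..b}" using pos Nh by auto
      then show "e 0 i = 0" using U0[OF \<open>i \<le> N\<close>] sol(1) by (simp add: e_def V_def grid_values_def)
    next
      fix n assume "n \<le> M"
      then have "real n * \<tau> \<le> real M * \<tau>" using pos by (intro mult_right_mono) auto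
      then have "real n * \<tau> \<in> {0..T}" using pos M\<tau> by auto
      moreover have "a + real N * h = b" using Nh by simp
      ultimately show "e n 0 = 0 \<and> e n N = 0"
        using Ub[OF \<open>n \<le> M\<close>] sol(2) by (simp add: e_def V_def grid_values_def)
    next
      fix n i assume "n < M" "i \<in> {1..<N}"
      \<comment> \<open>Subtracting the two schemes cancels the source term and leaves the
        truncation error.\<close>
      then show "cn_implicit p q \<alpha> K1 K2 N h \<tau> (e (Suc n)) i =
          cn_explicit p q \<alpha> K1 K2 N h \<tau> (e n) i + \<tau> * \<epsilon> n i"
        using \<epsilon> scheme unfolding e_def cn_implicit_diff cn_explicit_diff by simp
      have "c * (\<tau>\<^sup>2 + h\<^sup>2) \<le> \<delta>" unfolding \<delta>_def by (intro mult_right_mono) auto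
      then show "\<bar>\<epsilon> n i\<bar> \<le> \<delta>" using \<epsilon>[OF \<open>n < M\<close> \<open>i \<in> {1..<N}\<close>] by linarith
    qed (use assms pos n in \<open>auto simp: \<delta>_def\<close>)
    \<comment> \<open>Replacing the elapsed time by the final time makes the bound independent of
      \<open>n\<close>.\<close>
    also have "\<dots> \<le> (real M * \<tau>) * (sqrt (real N * h) * \<delta>)"
      using n pos by (intro mult_right_mono) (auto simp: \<delta>_def)
    also have "\<dots> = (C - 1) * (\<tau>\<^sup>2 + h\<^sup>2)" unfolding Nh M\<tau> by (simp add: C_def \<delta>_def)
    also have "\<dots> \<le> C * (\<tau>\<^sup>2 + h\<^sup>2)" by (intro mult_right_mono) auto
    finally show ?thesis unfolding e_def V_def h_def \<tau>_def .
  qed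
  show ?thesis using C bound by blast
qed

end
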